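(* For every integer $n\ge1$, $$\left\lfloor\left(\sum_{k=n}^\infty\frac{(-1)^k}{B_kB_{k+1}}\right)^{-1}\right\rfloor=\begin{cases}B_nB_{n+1}+B_{n-1}B_n&\text{if $n$ is even},\\ -(B_nB_{n+1}+B_{n-1}B_n+1)&\text{if $n$ is odd}.\end{cases}$$
   Context: The balancing numbers are defined by $B_0=0$, $B_1=1$, $B_n=6B_{n-1}-B_{n-2}$ for $n\ge 2$. $\lfloor x\rfloor$ denotes the floor of a real number $x$. *)

theory Defs
  imports "HOL-Analysis.Analysis"
begin

fun balancing :: "nat \<Rightarrow> int" where
  "balancing 0 = 0"
| "balancing (Suc 0) = 1"
| "balancing (Suc (Suc n)) = 6 * balancing (Suc n) - balancing n"

end

theory Submission
  imports Defs
begin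

text \<open>
  Since \<open>B\<^sub>n\<^sub>+\<^sub>1 + B\<^sub>n\<^sub>-\<^sub>1 = 6 B\<^sub>n\<close>, the number \<open>B\<^sub>n B\<^sub>n\<^sub>+\<^sub>1 + B\<^sub>n\<^sub>-\<^sub>1 B\<^sub>n\<close> is \<open>6 B\<^sub>n\<^sup>2\<close>. Since
  \<open>B\<^sub>n\<^sup>2 + B\<^sub>n\<^sub>+\<^sub>1\<^sup>2 = 6 B\<^sub>n B\<^sub>n\<^sub>+\<^sub>1 + 1\<close>, the general term \<open>1 / (B\<^sub>n B\<^sub>n\<^sub>+\<^sub>1)\<close> equals
  \<open>1 / (6 B\<^sub>n\<^sup>2) + 1 / (6 B\<^sub>n\<^sub>+\<^sub>1\<^sup>2) - e\<^sub>n\<close> with \<open>e\<^sub>n = 1 / (6 B\<^sub>n\<^sup>2 B\<^sub>n\<^sub>+\<^sub>1\<^sup>2)\<close>. The alternating sum of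
  the first two parts telescopes to \<open>1 / (6 B\<^sub>n\<^sup>2)\<close>, and the alternating sum of the \<open>e\<^sub>k\<close> lies
  strictly between \<open>0\<close> and \<open>1 / (6 B\<^sub>n\<^sup>2) - 1 / (6 B\<^sub>n\<^sup>2 + 1)\<close> by Leibniz and \<open>B\<^sub>n\<^sub>+\<^sub>1 \<ge> 5 B\<^sub>n\<close>.
\<close>

text \<open>For consecutive values x, y the step needs 6y - x >= 5y + 1, that is x + 1 <= y. This
  follows from 5x + 1 <= y once x >= 0, so both claims share one induction.\<close>

lemma balancing_growth: "0 \<le> balancing n \<and> 5 * balancing n + 1 \<le> balancing (Suc n)"
  by (induction n) auto

lemma balancing_ge: "int n \<le> balancing n"
proof (induction n)
  case (Suc n)
  then show ?case using balancing_growth[of n] by simp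
qed simp

text \<open>The recurrence step (x, y) to (y, 6y - x) preserves the form x^2 - 6xy + y^2, whose
  value at the start (0, 1) is 1.\<close>

lemma balancing_invariant:
  "(balancing n)\<^sup>2 + (balancing (Suc n))\<^sup>2 = 6 * balancing n * balancing (Suc n) + 1"
proof (induction n)
  case (Suc n)
  then show ?case by (simp add: power2_eq_square algebra_simps)
qed simp

lemma balancing_neighbours:
  assumes "n \<ge> 1"
  shows "balancing n * balancing (n + 1) + balancing (n - 1) * balancing n = 6 * (balancing n)\<^sup>2"
  using assms by (cases n) (auto simp: power2_eq_square algebra_simps)

text \<open>With the sign (-1)^n factored out, one pair of bounds serves both parities: 1/T lies
  strictly between two consecutive integers.\<close>

lemma alternating_reciprocal_sum_bounds:
  assumes "n \<ge> 1"
  obtains T where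
    "(\<lambda>i. (-1) ^ i /
       (real_of_int (balancing (n + i)) * real_of_int (balancing (n + i + 1)))) sums T"
    "T < 1 / (6 * (real_of_int (balancing n))\<^sup>2)"
    "1 / (6 * (real_of_int (balancing n))\<^sup>2 + 1) < T"
proof -
  define b where "b i = real_of_int (balancing (n + i))" for i
  define c where "c i = 1 / (6 * (b i)\<^sup>2)" for i
  define e where "e i = c i / (b (Suc i))\<^sup>2" for i
  have b_ge: "real i + 1 \<le> b i" for i
    using balancing_ge[of "n + i"] assms(1) unfolding b_def by linarith
  have b_ge1: "1 \<le> b i" for i
    using b_ge[of i] by linarith
  have b_pos: "0 < b i" for i
    using b_ge1[of i] by linarith
  have b_growth: "5 * b i + 1 \<le> b (Suc i)" for i
    using balancing_growth[of "n + i"] unfolding b_def by simp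
  have b_inv: "(b i)\<^sup>2 + (b (Suc i))\<^sup>2 = 6 * b i * b (Suc i) + 1" for i
    using arg_cong[OF balancing_invariant[of "n + i"], of real_of_int] unfolding b_def by simp
  have b_sq: "6 * (b i)\<^sup>2 + 1 < (b (Suc i))\<^sup>2" for i
  proof -
    have "(5 * b i + 1)\<^sup>2 \<le> (b (Suc i))\<^sup>2"
      using b_growth[of i] b_pos[of i] by (intro power_mono) auto
    moreover have "(5 * b i + 1)\<^sup>2 = 25 * (b i)\<^sup>2 + 10 * b i + 1"
      by (simp add: power2_eq_square algebra_simps)
    ultimately show ?thesis
      using b_pos[of i] zero_le_power2[of "b i"] by linarith
  qed
  have c_pos: "0 < c i" for i
    using b_pos[of i] by (simp add: c_def)
  have e_pos: "0 < e i" for i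
    using c_pos[of i] b_pos[of "Suc i"] by (simp add: e_def)
  have c_less: "c (Suc i) < c i" for i
  proof -
    have "(b i)\<^sup>2 < (b (Suc i))\<^sup>2"
      using b_sq[of i] zero_le_power2[of "b i"] by linarith
    then show ?thesis
      unfolding c_def using b_pos[of i] b_pos[of "Suc i"]
      by (intro divide_strict_left_mono) auto
  qed
  have e_less: "e (Suc i) < e i" for i
  proof -
    have "(b (Suc i))\<^sup>2 \<le> (b (Suc (Suc i)))\<^sup>2"
      using b_sq[of "Suc i"] zero_le_power2[of "b (Suc i)"] by linarith
    then show ?thesis
      unfolding e_def using c_less[of i] c_pos[of "Suc i"] b_pos[of "Suc i"]
      by (intro frac_less) (auto intro: less_imp_le)
  qed
  have c_le: "c i \<le> inverse (real (Suc i))" for i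
  proof -
    have "1 * (real i + 1) \<le> b i * b i"
      using b_ge[of i] b_ge1[of i] by (intro mult_mono) auto
    then have "real (Suc i) \<le> 6 * (b i)\<^sup>2"
      using zero_le_power2[of "b i"] unfolding power2_eq_square by simp
    then show ?thesis
      unfolding c_def inverse_eq_divide by (intro frac_le) auto
  qed
  have c_lim: "c \<longlonglongrightarrow> 0"
    by (rule tendsto_sandwich[OF _ _ tendsto_const LIMSEQ_inverse_real_of_nat])
      (use c_pos c_le in \<open>auto intro!: always_eventually less_imp_le\<close>)
  have e_le: "e i \<le> c i" for i
    using c_pos[of i] one_le_power[OF b_ge1[of "Suc i"], of 2]
    by (simp add: e_def divide_le_eq mult_left_mono mult_le_cancel_left1)
  have e_lim: "e \<longlonglongrightarrow> 0"
    by (rule tendsto_sandwich[OF _ _ tendsto_const c_lim])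
      (use e_pos e_le in \<open>auto intro!: always_eventually less_imp_le\<close>)
  have c_tele: "(\<lambda>i. (-1) ^ i * (c i + c (Suc i))) sums c 0"
  proof -
    have "(\<lambda>i. \<bar>(-1) ^ i * c i\<bar>) \<longlonglongrightarrow> 0"
      using c_lim c_pos by (simp add: abs_mult power_abs less_imp_le)
    then have "(\<lambda>i. (-1) ^ i * c i) \<longlonglongrightarrow> 0"
      by (rule tendsto_rabs_zero_cancel)
    \<comment> \<open>The alternating sign turns the difference of consecutive terms
      \<open>(-1) ^ i * c i\<close> into the sum \<open>c i + c (Suc i)\<close>.\<close>
    from telescope_sums'[OF this] show ?thesis
      by (simp add: algebra_simps)
  qed
  have mono: "e (Suc i) \<le> e i" for i
    using e_less[of i] by simp
  have e_nonneg: "0 \<le> e i" for i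
    using e_pos[of i] by simp
  note Leibniz = summable_Leibniz'[OF e_lim e_nonneg mono]
  define d where "d = (\<Sum>i. (-1) ^ i * e i)"
  \<comment> \<open>The two-term partial sum \<open>e 0 - e 1\<close> bounds \<open>d\<close> from
    below; the empty one would give only \<open>0 \<le> d\<close>.\<close>
  have d_pos: "0 < d"
    using Leibniz(2)[of 1] e_less[of 0] by (simp add: d_def numeral_2_eq_2)
  have d_le: "d \<le> e 0"
    using Leibniz(4)[of 0] by (simp add: d_def)
  have split: "1 / (b i * b (Suc i)) = (c i + c (Suc i)) - e i" for i
  proof -
    have "c i + c (Suc i) - e i = ((b i)\<^sup>2 + (b (Suc i))\<^sup>2 - 1) / (6 * (b i)\<^sup>2 * (b (Suc i))\<^sup>2)"
      using b_pos[of i] b_pos[of "Suc i"] by (simp add: c_def e_def field_simps)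
    also have "\<dots> = 1 / (b i * b (Suc i))"
      unfolding b_inv using b_pos[of i] b_pos[of "Suc i"]
      by (simp add: field_simps power2_eq_square)
    finally show ?thesis by simp
  qed
  have "(\<lambda>i. (-1) ^ i * (c i + c (Suc i)) - (-1) ^ i * e i) sums (c 0 - d)"
    unfolding d_def by (intro sums_diff c_tele summable_sums Leibniz(1))
  also have "(\<lambda>i. (-1) ^ i * (c i + c (Suc i)) - (-1) ^ i * e i) =
      (\<lambda>i. (-1) ^ i / (b i * b (Suc i)))"
  proof
    fix i
    have "(-1) ^ i / (b i * b (Suc i)) = (-1) ^ i * (1 / (b i * b (Suc i)))" by simp
    then show "(-1) ^ i * (c i + c (Suc i)) - (-1) ^ i * e i = (-1) ^ i / (b i * b (Suc i))"
      unfolding split by (simp add: algebra_simps)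
  qed
  finally have "(\<lambda>i. (-1) ^ i / (real_of_int (balancing (n + i)) *
      real_of_int (balancing (n + i + 1)))) sums (c 0 - d)"
    by (simp add: b_def)
  moreover have "c 0 - d < 1 / (6 * (real_of_int (balancing n))\<^sup>2)"
    using d_pos by (simp add: c_def b_def)
  moreover have "1 / (6 * (real_of_int (balancing n))\<^sup>2 + 1) < c 0 - d"
  proof -
    \<comment> \<open>With x = 6 \<open>(b 0)\<^sup>2\<close>, \<open>b_sq\<close> puts
      \<open>e 0\<close> below 1/(x (x + 1)) = 1/x - 1/(x + 1), where \<open>c 0\<close> is
      1/x.\<close>
    have "e 0 < c 0 / (6 * (b 0)\<^sup>2 + 1)"
      unfolding e_def using b_sq[of 0] c_pos[of 0] b_pos[of 1] b_pos[of 0]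
      by (intro divide_strict_left_mono) (auto intro!: mult_pos_pos add_pos_pos)
    also have "\<dots> = c 0 - 1 / (6 * (b 0)\<^sup>2 + 1)"
    proof -
      have "6 * (b 0)\<^sup>2 + 1 \<noteq> 0" "b 0 \<noteq> 0"
        using zero_le_power2[of "b 0"] b_pos[of 0] by linarith+
      then show ?thesis by (simp add: c_def divide_simps)
    qed
    finally show ?thesis
      using d_le by (simp add: b_def)
  qed
  ultimately show thesis by (rule that)
qed

theorem theorem9:
  fixes n :: nat
  assumes "n \<ge> 1"
  shows "\<lfloor>inverse (\<Sum>i. (-1) ^ (n + i) /
             (real_of_int (balancing (n + i)) * real_of_int (balancing (n + i + 1))))\<rfloor> =
         (if even n
          then balancing n * balancing (n + 1) + balancing (n - 1) * balancing n
          else - (balancing n * balancing (n + 1) + balancing (n - 1) * balancing n + 1))"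
proof -
  define t where "t i = (-1) ^ i /
    (real_of_int (balancing (n + i)) * real_of_int (balancing (n + i + 1)))" for i
  define a where "a = 6 * (balancing n)\<^sup>2"
  have a_pos: "0 < a"
    using balancing_ge[of n] assms by (simp add: a_def)
  obtain T where sums: "t sums T"
    and upper: "T < 1 / real_of_int a" and lower: "1 / (real_of_int a + 1) < T"
    using alternating_reciprocal_sum_bounds[OF assms] unfolding t_def a_def by auto
  have T_pos: "0 < T"
    using lower a_pos by (smt (verit) divide_pos_pos of_int_0_less_iff)
  have gt: "real_of_int a < inverse T" and less: "inverse T < real_of_int a + 1"
    using upper lower T_pos a_pos by (simp_all add: field_simps)
  have "(\<lambda>i. (-1) ^ (n + i) /
      (real_of_int (balancing (n + i)) * real_of_int (balancing (n + i + 1)))) =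
      (\<lambda>i. (-1) ^ n * t i)"
    by (simp add: t_def power_add)
  also have "\<dots> sums ((-1) ^ n * T)"
    by (intro sums_mult sums)
  finally have "(\<Sum>i. (-1) ^ (n + i) / (real_of_int (balancing (n + i)) *
      real_of_int (balancing (n + i + 1)))) = (-1) ^ n * T"
    by (rule sums_unique[symmetric])
  \<comment> \<open>For odd \<open>n\<close> the inverse is \<open>- inverse T\<close>, between -(a
    + 1) and -a. Strictness of \<open>gt\<close> rules out the floor -a there; for even
    \<open>n\<close>, strictness of \<open>less\<close> rules out a + 1.\<close>
  then show ?thesis
    unfolding balancing_neighbours[OF assms] a_def[symmetric]
    using gt less by (auto simp: floor_eq_iff inverse_minus_eq)
qed

end
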